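(* Assume that $f\in L^1(X,\nu)$ and let $\lambda>0$. Let $v_0\in L^2(X,\nu)$ and $v(t):=T_\lambda(t)v_0$, where $(T_\lambda(t))_{t\ge0}$ is the semigroup in $L^2(X,\nu)$ solving $$v_t\in\Delta_1^m v(t)-\lambda\,\mathrm{sign}(v(t)-f)\ \text{ in }(0,\infty)\times X,\qquad v(0)=v_0.$$ If the $\omega$-limit set $$\omega(v_0):=\{w\in L^2(X,\nu)\ :\ \exists\,t_n\to+\infty\ \text{ such that }\lim_{n\to\infty}v(t_n)=w\}$$ (limits in $L^2(X,\nu)$) is non-empty, then there exists $u^*\in M(f,\lambda)$ such that $$\lim_{t\to\infty}v(t)=u^*\quad\text{in }L^2(X,\nu).$$
   Context: Setting: $(X,d)$ is a Polish metric space with its Borel $\sigma$-algebra. A random walk $m=(m_x)_{x\in X}$ on $X$ is a family of Borel probability measures on $X$ such that $x\mapsto m_x(A)$ is Borel for every Borel $A\subset X$ and $\int_X d(z,y)\,dm_x(y)<\infty$ for all $x\in X$ and some (hence any) $z\in X$; $[X,d,m]$ is a metric random walk space. $\nu$ is a finite (nonzero) Radon measure on $X$ which is reversible for $m$: $dm_x(y)d\nu(x)=dm_y(x)d\nu(y)$ as measures on $X\times X$ (this implies invariance, $\nu(A)=\int_X m_x(A)\,d\nu(x)$). It is also assumed that $\frac1{\nu(X)}\nu$ is ergodic with respect to $m$: every Borel set $B$ with $m_x(B)=1$ for all $x\in B$ satisfies $\nu(B)=0$ or $\nu(B)=\nu(X)$. $m$-total variation: $TV_m(u)=\frac12\int_X\int_X|u(y)-u(x)|\,dm_x(y)\,d\nu(x)$.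 $\mathcal F_m:L^2(X,\nu)\to\,]-\infty,+\infty]$, $\mathcal F_m(u)=TV_m(u)$, is convex and lower semicontinuous; $\partial\mathcal F_m$ is its subdifferential in $L^2(X,\nu)$. $\Delta_1^m$ is the multivalued operator in $L^2(X,\nu)$ with $v\in\Delta_1^m(u)$ iff $-v\in\partial\mathcal F_m(u)$. $\mathcal E_m(u,f,\lambda)=TV_m(u)+\lambda\int_X|u-f|\,d\nu$, and $M(f,\lambda)$ is the set of $u\in L^1(X,\nu)$ minimizing $\mathcal E_m(\cdot,f,\lambda)$ over $L^1(X,\nu)$. $\xi\in\mathrm{sign}(u)$ means $\xi$ is $\nu$-measurable and, $\nu$-a.e., $\xi=1$ where $u>0$, $\xi=-1$ where $u<0$, $\xi\in[-1,1]$ where $u=0$. For $v_0\in L^2(X,\nu)$, $v(t)=T_\lambda(t)v_0$ is the unique strong solution of the Cauchy problem: for every $T>0$, $v\in C([0,T];L^2(X,\nu))\cap W^{1,1}_{loc}(0,T;L^2(X,\nu))$, $v(0)=v_0$, and for almost all $t\in(0,T)$ there exists $\xi(t)\in\mathrm{sign}(v(t)-f)$ with $\lambda\xi(t)+v_t(t)\in\Delta_1^m(v(t))$. Equivalently, it is the gradient flow in $L^2(X,\nu)$ of the convex lower semicontinuous functional $\mathcal E_m(\cdot,f,\lambda)$. *)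

theory Defs
  imports "HOL-Probability.Probability"
begin

section \<open>Metric random walk spaces\<close>

definition random_walk :: "('a::polish_space \<Rightarrow> 'a measure) \<Rightarrow> bool" where
  "random_walk m \<longleftrightarrow>
     (\<forall>x. sets (m x) = sets borel \<and> prob_space (m x)) \<and>
     (\<forall>A\<in>sets borel. (\<lambda>x. measure (m x) A) \<in> borel_measurable borel) \<and>
     (\<exists>z. \<forall>x. (\<integral>\<^sup>+y. ennreal (dist z y) \<partial>m x) < \<infinity>)"

text \<open>Only finite measures occur here, so local finiteness is subsumed by finiteness.\<close>

definition finite_radon_measure :: "('a::topological_space) measure \<Rightarrow> bool" where
  "finite_radon_measure \<nu> \<longleftrightarrow>
     sets \<nu> = sets borel \<and> finite_measure \<nu> \<and>
     (\<forall>A\<in>sets borel. emeasure \<nu> A = (SUP K\<in>{K. compact K \<and> K \<subseteq> A}. emeasure \<nu> K))"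

text \<open>Equality of the measures \<open>dm\<^sub>x(y)d\<nu>(x)\<close> and \<open>dm\<^sub>y(x)d\<nu>(y)\<close>, tested on Borel sets of the
  product space.\<close>

definition reversible :: "('a::polish_space \<Rightarrow> 'a measure) \<Rightarrow> 'a measure \<Rightarrow> bool" where
  "reversible m \<nu> \<longleftrightarrow>
     (\<forall>C\<in>sets (borel :: ('a \<times> 'a) measure).
        (\<integral>\<^sup>+x. emeasure (m x) {y. (x, y) \<in> C} \<partial>\<nu>) = (\<integral>\<^sup>+y. emeasure (m y) {x. (x, y) \<in> C} \<partial>\<nu>))"

definition ergodic :: "('a::polish_space \<Rightarrow> 'a measure) \<Rightarrow> 'a measure \<Rightarrow> bool" where
  "ergodic m \<nu> \<longleftrightarrow>
     (\<forall>B\<in>sets borel. (\<forall>x\<in>B. emeasure (m x) B = 1) \<longrightarrow>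
        emeasure \<nu> B = 0 \<or> emeasure \<nu> B = emeasure \<nu> UNIV)"


section \<open>The space \<open>L\<^sup>2(X, \<nu>)\<close>\<close>

text \<open>Elements of \<open>L\<^sup>2(X, \<nu>)\<close> are represented by functions; equality is equality almost everywhere.
  \<open>L2_dist\<close> is meaningful only between members of \<open>L2_space\<close> (the Bochner integral is \<open>0\<close> on
  non-integrable functions), so it is always accompanied by a membership condition.\<close>

definition L2_space :: "'a measure \<Rightarrow> ('a \<Rightarrow> real) set" where
  "L2_space \<nu> = {u \<in> borel_measurable \<nu>. integrable \<nu> (\<lambda>x. (u x)\<^sup>2)}"

definition L2_dist :: "'a measure \<Rightarrow> ('a \<Rightarrow> real) \<Rightarrow> ('a \<Rightarrow> real) \<Rightarrow> real" where
  "L2_dist \<nu> u w = sqrt (\<integral>x. (u x - w x)\<^sup>2 \<partial>\<nu>)"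

definition L2_subdifferential ::
    "'a measure \<Rightarrow> (('a \<Rightarrow> real) \<Rightarrow> ereal) \<Rightarrow> ('a \<Rightarrow> real) \<Rightarrow> ('a \<Rightarrow> real) set" where
  "L2_subdifferential \<nu> F u =
     {v \<in> L2_space \<nu>. u \<in> L2_space \<nu> \<and>
        (\<forall>w\<in>L2_space \<nu>. F w \<ge> F u + ereal (\<integral>x. v x * (w x - u x) \<partial>\<nu>))}"

definition L2_continuous_on :: "'a measure \<Rightarrow> real set \<Rightarrow> (real \<Rightarrow> 'a \<Rightarrow> real) \<Rightarrow> bool" where
  "L2_continuous_on \<nu> S v \<longleftrightarrow>
     (\<forall>t\<in>S. v t \<in> L2_space \<nu> \<and> ((\<lambda>s. L2_dist \<nu> (v s) (v t)) \<longlongrightarrow> 0) (at t within S))"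

text \<open>The Bochner integral of an \<open>L\<^sup>2(X, \<nu>)\<close>-valued function \<open>g\<close> with respect to a finite measure \<open>M\<close>,
  by approximation with simple functions; the library's Bochner integral needs the values to lie in
  a normed space type. Almost everywhere convergence is the strong measurability of \<open>g\<close>, and the sum
  is the integral of the simple function \<open>s n\<close>.\<close>

definition has_L2_bochner_integral ::
    "'a measure \<Rightarrow> 'b measure \<Rightarrow> ('b \<Rightarrow> 'a \<Rightarrow> real) \<Rightarrow> ('a \<Rightarrow> real) \<Rightarrow> bool" where
  "has_L2_bochner_integral \<nu> M g J \<longleftrightarrow>
     J \<in> L2_space \<nu> \<and> (AE t in M. g t \<in> L2_space \<nu>) \<and>
     (\<exists>s :: nat \<Rightarrow> 'b \<Rightarrow> 'a \<Rightarrow> real.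
        (\<forall>n. simple_function M (s n) \<and> (\<forall>t\<in>space M. s n t \<in> L2_space \<nu>)) \<and>
        (AE t in M. (\<lambda>n. L2_dist \<nu> (s n t) (g t)) \<longlonglongrightarrow> 0) \<and>
        (\<lambda>n. \<integral>\<^sup>+t. ennreal (L2_dist \<nu> (s n t) (g t)) \<partial>M) \<longlonglongrightarrow> 0 \<and>
        (\<lambda>n. L2_dist \<nu> (\<lambda>x. \<Sum>h\<in>s n ` space M. measure M {t \<in> space M. s n t = h} * h x) J)
          \<longlonglongrightarrow> 0)"

text \<open>\<open>v \<in> W\<^sup>1\<^sup>,\<^sup>1\<^sub>l\<^sub>o\<^sub>c(0, T; L\<^sup>2(X, \<nu>))\<close> with derivative \<open>g\<close>, in the usual sense for vector-valued
  functions: \<open>g\<close> is locally Bochner integrable and \<open>v\<close> is a primitive of \<open>g\<close>. Such a \<open>g\<close> is unique up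
  to equality for almost every \<open>t\<close>.\<close>

definition L2_W11_loc_deriv ::
    "'a measure \<Rightarrow> real \<Rightarrow> (real \<Rightarrow> 'a \<Rightarrow> real) \<Rightarrow> (real \<Rightarrow> 'a \<Rightarrow> real) \<Rightarrow> bool" where
  "L2_W11_loc_deriv \<nu> T v g \<longleftrightarrow>
     (\<forall>t\<in>{0<..<T}. v t \<in> L2_space \<nu>) \<and>
     (\<forall>a b. 0 < a \<and> a \<le> b \<and> b < T \<longrightarrow>
        has_L2_bochner_integral \<nu> (lebesgue_on {a..b}) g (\<lambda>x. v b x - v a x))"


section \<open>Total variation, the 1-Laplacian and the energy\<close>

definition TV :: "('a \<Rightarrow> 'a measure) \<Rightarrow> 'a measure \<Rightarrow> ('a \<Rightarrow> real) \<Rightarrow> ennreal" where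
  "TV m \<nu> u = ennreal (1/2) * (\<integral>\<^sup>+x. (\<integral>\<^sup>+y. ennreal \<bar>u y - u x\<bar> \<partial>m x) \<partial>\<nu>)"

definition Laplacian1 :: "('a \<Rightarrow> 'a measure) \<Rightarrow> 'a measure \<Rightarrow> ('a \<Rightarrow> real) \<Rightarrow> ('a \<Rightarrow> real) set" where
  "Laplacian1 m \<nu> u =
     {v \<in> L2_space \<nu>. (\<lambda>x. - v x) \<in> L2_subdifferential \<nu> (\<lambda>w. enn2ereal (TV m \<nu> w)) u}"

definition energy ::
    "('a \<Rightarrow> 'a measure) \<Rightarrow> 'a measure \<Rightarrow> ('a \<Rightarrow> real) \<Rightarrow> real \<Rightarrow> ('a \<Rightarrow> real) \<Rightarrow> ennreal" where
  "energy m \<nu> f l u = TV m \<nu> u + ennreal l * (\<integral>\<^sup>+x. ennreal \<bar>u x - f x\<bar> \<partial>\<nu>)"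

definition minimizers ::
    "('a \<Rightarrow> 'a measure) \<Rightarrow> 'a measure \<Rightarrow> ('a \<Rightarrow> real) \<Rightarrow> real \<Rightarrow> ('a \<Rightarrow> real) set" where
  "minimizers m \<nu> f l =
     {u. integrable \<nu> u \<and> (\<forall>w. integrable \<nu> w \<longrightarrow> energy m \<nu> f l u \<le> energy m \<nu> f l w)}"

definition sign_graph :: "'a measure \<Rightarrow> ('a \<Rightarrow> real) \<Rightarrow> ('a \<Rightarrow> real) set" where
  "sign_graph \<nu> u =
     {\<xi> \<in> borel_measurable \<nu>. AE x in \<nu>.
        (u x > 0 \<longrightarrow> \<xi> x = 1) \<and> (u x < 0 \<longrightarrow> \<xi> x = -1) \<and> (u x = 0 \<longrightarrow> \<xi> x \<in> {-1..1})}"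


section \<open>The gradient flow\<close>

text \<open>\<open>v\<close> represents the curve \<open>t \<mapsto> T\<^sub>\<lambda>(t)v\<^sub>0\<close>, for \<open>t \<ge> 0\<close>; its values for \<open>t < 0\<close> are irrelevant.\<close>

definition strong_solution ::
    "('a \<Rightarrow> 'a measure) \<Rightarrow> 'a measure \<Rightarrow> ('a \<Rightarrow> real) \<Rightarrow> real \<Rightarrow> ('a \<Rightarrow> real) \<Rightarrow>
     (real \<Rightarrow> 'a \<Rightarrow> real) \<Rightarrow> bool" where
  "strong_solution m \<nu> f l v0 v \<longleftrightarrow>
     (AE x in \<nu>. v 0 x = v0 x) \<and>
     (\<forall>T>0. L2_continuous_on \<nu> {0..T} v \<and>
        (\<exists>g. L2_W11_loc_deriv \<nu> T v g \<and>
          (AE t in lebesgue_on {0<..<T}.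
             \<exists>\<xi>\<in>sign_graph \<nu> (\<lambda>x. v t x - f x).
               (\<lambda>x. l * \<xi> x + g t x) \<in> Laplacian1 m \<nu> (v t))))"

definition omega_limit :: "'a measure \<Rightarrow> (real \<Rightarrow> 'a \<Rightarrow> real) \<Rightarrow> ('a \<Rightarrow> real) set" where
  "omega_limit \<nu> v =
     {w \<in> L2_space \<nu>. \<exists>t :: nat \<Rightarrow> real. filterlim t at_top sequentially \<and>
        (\<lambda>n. L2_dist \<nu> (v (t n)) w) \<longlonglongrightarrow> 0}"

end

theory Submission imports Defs begin

text \<open>
  Write \<open>J\<close> for the energy \<open>u \<mapsto> TV\<^sub>m(u) + \<lambda> \<integral> |u - f| d\<nu>\<close>. Adding the subgradient inequalities of
  \<open>TV\<^sub>m\<close> and of the fidelity term shows that a strong solution \<open>v\<close> is an \<open>L\<^sup>2\<close> gradient flow of \<open>J\<close>: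
  \<open>- v\<^sub>t \<in> \<partial>J(v(t))\<close> for almost every \<open>t\<close> (\<open>J_subgradient\<close>). A gradient flow of a convex functional
  satisfies the evolution variational inequality: if \<open>c \<le> J(v(s))\<close> for \<open>a \<le> s \<le> b\<close>, then
  \<open>\<parallel>v(b) - w\<parallel>\<^sup>2 - \<parallel>v(a) - w\<parallel>\<^sup>2 \<le> 2 (b - a) (J(w) - c)\<close> for all \<open>w \<in> L\<^sup>2\<close>
  (\<open>variational_inequality\<close>), and everything follows from this inequality.

  \<^item> The energy does not increase along \<open>v\<close>: otherwise there would be an interval \<open>[p, b]\<close> on which it
    stays above \<open>J(v(p))\<close> while \<open>J(v(p)) < J(v(b))\<close>; the choice \<open>w = v(p)\<close>, \<open>c = J(v(p))\<close> then gives
    \<open>v(b) = v(p)\<close>, a contradiction (\<open>energy_antimono\<close>).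
  \<^item> Let \<open>u\<close> be in the \<open>\<omega>\<close>-limit set. As \<open>J(v(t))\<close> is nonincreasing and \<open>J\<close> continuous, \<open>J(u)\<close> is a lower
    bound of the energy along \<open>v\<close>. If \<open>J(w) < J(u)\<close> for some \<open>w\<close>, then \<open>\<parallel>v(t) - w\<parallel>\<^sup>2\<close> would decrease
    at least linearly forever; hence \<open>u\<close> minimizes \<open>J\<close> over \<open>L\<^sup>2\<close> (\<open>omega_limit_minimizes\<close>).
  \<^item> With \<open>w = u\<close> and \<open>c = J(u)\<close> the inequality says that \<open>\<parallel>v(t) - u\<parallel>\<close> is nonincreasing. It tends to
    \<open>0\<close> along a sequence, therefore along all \<open>t \<rightarrow> \<infinity>\<close> (\<open>converges_to_omega_limit\<close>).

  One special feature shortens the argument. Since \<open>\<nu>\<close> is invariant, \<open>TV\<^sub>m(u) \<le> TV\<^sub>m(w) + \<parallel>u - w\<parallel>\<^sub>1\<close>, so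
  \<open>J\<close> is Lipschitz on \<open>L\<^sup>1\<close> and, \<open>\<nu>\<close> being finite, on \<open>L\<^sup>2\<close>. Its subgradients are then bounded, \<open>v\<close> is a
  Lipschitz curve, and the variational inequality follows from the integral form of the equation by
  subdividing \<open>[a, b]\<close>. The Lipschitz bound in \<open>L\<^sup>1\<close> also transfers minimality from \<open>L\<^sup>2\<close> to \<open>L\<^sup>1\<close>, by
  truncation.
\<close>


section \<open>Geometry of \<open>L\<^sup>2\<close>\<close>

definition L2_norm :: "'a measure \<Rightarrow> ('a \<Rightarrow> real) \<Rightarrow> real" where
  "L2_norm M u = sqrt (\<integral>x. (u x)\<^sup>2 \<partial>M)"

lemma L2_dist_eq_norm: "L2_dist M u w = L2_norm M (\<lambda>x. u x - w x)"
  by (simp add: L2_dist_def L2_norm_def)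

lemma L2_norm_nonneg [simp]: "0 \<le> L2_norm M u"
  by (simp add: L2_norm_def)

lemma L2_norm_square: "(L2_norm M u)\<^sup>2 = (\<integral>x. (u x)\<^sup>2 \<partial>M)"
  by (simp add: L2_norm_def)

lemma L2_dist_nonneg [simp]: "0 \<le> L2_dist M u w"
  by (simp add: L2_dist_def)

lemma L2_dist_commute: "L2_dist M u w = L2_dist M w u"
  unfolding L2_dist_def by (subst power2_commute) (rule refl)

lemma L2_space_measurable: "u \<in> L2_space M \<Longrightarrow> u \<in> borel_measurable M"
  by (simp add: L2_space_def)

lemma L2_space_square_integrable: "u \<in> L2_space M \<Longrightarrow> integrable M (\<lambda>x. (u x)\<^sup>2)"
  by (simp add: L2_space_def)

lemma L2_space_mult_integrable:
  assumes "u \<in> L2_space M" "w \<in> L2_space M"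
  shows "integrable M (\<lambda>x. u x * w x)"
proof (rule Bochner_Integration.integrable_bound[of M "\<lambda>x. (u x)\<^sup>2 + (w x)\<^sup>2"])
  show "integrable M (\<lambda>x. (u x)\<^sup>2 + (w x)\<^sup>2)" "(\<lambda>x. u x * w x) \<in> borel_measurable M"
    using assms by (auto simp: L2_space_def)
  have "\<bar>a * b\<bar> \<le> \<bar>a\<^sup>2 + b\<^sup>2\<bar>" for a b :: real
    using sum_squares_bound[of "\<bar>a\<bar>" "\<bar>b\<bar>"] abs_ge_zero[of "a * b"]
    unfolding abs_mult power2_abs by linarith
  then show "AE x in M. norm (u x * w x) \<le> norm ((u x)\<^sup>2 + (w x)\<^sup>2)"
    by simp
qed

lemma L2_space_lincomb:
  assumes "u \<in> L2_space M" "w \<in> L2_space M"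
  shows "(\<lambda>x. a * u x + b * w x) \<in> L2_space M"
proof -
  have "integrable M (\<lambda>x. a\<^sup>2 * (u x)\<^sup>2 + 2 * a * b * (u x * w x) + b\<^sup>2 * (w x)\<^sup>2)"
    using assms L2_space_mult_integrable[OF assms] by (auto simp: L2_space_def)
  moreover have "(a * u x + b * w x)\<^sup>2 = a\<^sup>2 * (u x)\<^sup>2 + 2 * a * b * (u x * w x) + b\<^sup>2 * (w x)\<^sup>2" for x
    by (simp add: power2_eq_square algebra_simps)
  ultimately show ?thesis
    using assms by (auto simp: L2_space_def)
qed

lemma L2_space_diff: "u \<in> L2_space M \<Longrightarrow> w \<in> L2_space M \<Longrightarrow> (\<lambda>x. u x - w x) \<in> L2_space M"
  using L2_space_lincomb[of u M w 1 "-1"] by simp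

lemma L2_space_zero: "(\<lambda>_. 0) \<in> L2_space M"
  by (simp add: L2_space_def)

lemma L2_space_sum:
  assumes "finite I" "\<And>i. i \<in> I \<Longrightarrow> u i \<in> L2_space M"
  shows "(\<lambda>x. \<Sum>i\<in>I. c i * u i x) \<in> L2_space M"
  using assms
proof (induction I rule: finite_induct)
  case empty
  then show ?case by (simp add: L2_space_zero)
next
  case (insert i I)
  then show ?case
    using L2_space_lincomb[of "u i" M "\<lambda>x. \<Sum>i\<in>I. c i * u i x" "c i" 1] by simp
qed

lemma L2_Cauchy_Schwarz:
  assumes "u \<in> L2_space M" "w \<in> L2_space M"
  shows "\<bar>\<integral>x. u x * w x \<partial>M\<bar> \<le> L2_norm M u * L2_norm M w"
proof -
  define A B D where "A = (\<integral>x. (u x)\<^sup>2 \<partial>M)" and "B = (\<integral>x. u x * w x \<partial>M)" and "D = (\<integral>x. (w x)\<^sup>2 \<partial>M)"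
  have quad: "0 \<le> A - 2 * t * B + t\<^sup>2 * D" for t
  proof -
    have "0 \<le> (\<integral>x. (u x - t * w x)\<^sup>2 \<partial>M)" by simp
    also have "\<dots> = (\<integral>x. (u x)\<^sup>2 - 2 * t * (u x * w x) + t\<^sup>2 * (w x)\<^sup>2 \<partial>M)"
      by (simp add: power2_eq_square algebra_simps)
    also have "\<dots> = A - 2 * t * B + t\<^sup>2 * D"
      using assms L2_space_mult_integrable[OF assms] by (simp add: A_def B_def D_def L2_space_def)
    finally show ?thesis .
  qed
  have "D \<ge> 0" by (simp add: D_def)
  have "B\<^sup>2 \<le> A * D"
  proof (cases "D = 0")
    case True
    \<comment> \<open>For \<open>D = 0\<close> the quadratic is affine in \<open>t\<close>; with slope \<open>B \<noteq> 0\<close> it takes the value \<open>- 1\<close>.\<close>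
    have "B = 0"
    proof (rule ccontr)
      assume "B \<noteq> 0"
      then show False using quad[of "(A + 1) / (2 * B)"] True by simp
    qed
    then show ?thesis using True by simp
  next
    case False
    with \<open>D \<ge> 0\<close> have "D > 0" by simp
    then show ?thesis using quad[of "B / D"] by (simp add: power2_eq_square field_simps)
  qed
  then have "sqrt (B\<^sup>2) \<le> sqrt (A * D)" by (rule real_sqrt_le_mono)
  then show ?thesis
    by (simp add: A_def B_def D_def L2_norm_def real_sqrt_mult)
qed

text \<open>The polarization identity \<open>\<parallel>p\<parallel>\<^sup>2 - \<parallel>q\<parallel>\<^sup>2 = 2 \<langle>p - q, p\<rangle> - \<parallel>p - q\<parallel>\<^sup>2\<close>. It takes over the part of the
  product rule for \<open>d/dt \<parallel>v(t) - w\<parallel>\<^sup>2\<close>: the last term has a favourable sign and can be dropped.\<close>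

lemma L2_dist_square_diff:
  assumes "u \<in> L2_space M" "z \<in> L2_space M" "w \<in> L2_space M"
  shows "(L2_dist M u w)\<^sup>2 - (L2_dist M z w)\<^sup>2
    = 2 * (\<integral>x. (u x - z x) * (u x - w x) \<partial>M) - (L2_dist M u z)\<^sup>2"
proof -
  have int: "integrable M (\<lambda>x. (u x - w x)\<^sup>2)" "integrable M (\<lambda>x. (z x - w x)\<^sup>2)" "integrable M (\<lambda>x. (u x - z x)\<^sup>2)"
    using assms by (auto intro: L2_space_square_integrable[OF L2_space_diff])
  have int': "integrable M (\<lambda>x. 2 * ((u x - z x) * (u x - w x)))"
    using assms by (intro integrable_mult_right L2_space_mult_integrable L2_space_diff)
  have "(\<integral>x. (u x - w x)\<^sup>2 \<partial>M) - (\<integral>x. (z x - w x)\<^sup>2 \<partial>M) = (\<integral>x. (u x - w x)\<^sup>2 - (z x - w x)\<^sup>2 \<partial>M)"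
    using int by simp
  also have "\<dots> = (\<integral>x. 2 * ((u x - z x) * (u x - w x)) - (u x - z x)\<^sup>2 \<partial>M)"
    by (rule arg_cong[where f = "integral\<^sup>L M"]) (auto simp: fun_eq_iff power2_eq_square algebra_simps)
  also have "\<dots> = 2 * (\<integral>x. (u x - z x) * (u x - w x) \<partial>M) - (\<integral>x. (u x - z x)\<^sup>2 \<partial>M)"
    unfolding Bochner_Integration.integral_diff[OF int' int(3)] by simp
  finally show ?thesis
    by (simp add: L2_dist_eq_norm L2_norm_square)
qed

section \<open>Testing a Bochner integral against a fixed vector\<close>

lemma simple_function_integral_eq_sum:
  fixes \<phi> :: "'b \<Rightarrow> real"
  assumes "finite_measure M" "simple_function M s"
  shows "integrable M (\<lambda>t. \<phi> (s t))"
    and "(\<integral>t. \<phi> (s t) \<partial>M) = (\<Sum>h\<in>s ` space M. measure M {t \<in> space M. s t = h} * \<phi> h)"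
proof -
  interpret finite_measure M by fact
  have fin: "finite (s ` space M)" using assms(2) by (simp add: simple_function_def)
  have meas: "{t \<in> space M. s t = h} \<in> sets M" if "h \<in> s ` space M" for h
    using assms(2) that by (auto simp: simple_function_def vimage_def Int_def conj_commute)
  have rep: "\<phi> (s t) = (\<Sum>h\<in>s ` space M. indicator {t \<in> space M. s t = h} t * \<phi> h)" if "t \<in> space M" for t
  proof -
    have "(\<Sum>h\<in>s ` space M. indicator {t \<in> space M. s t = h} t * \<phi> h) = (\<Sum>h\<in>s ` space M. if s t = h then \<phi> h else 0)"
      using that by (intro sum.cong) (auto simp: indicator_def)
    also have "\<dots> = \<phi> (s t)" using fin that by (simp add: sum.delta)
    finally show ?thesis by simp
  qed
  have int: "integrable M (\<lambda>t. indicator {t \<in> space M. s t = h} t * \<phi> h)" if "h \<in> s ` space M" for h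
    using meas[OF that] by (intro integrable_mult_left integrable_real_indicator) (auto simp: emeasure_eq_measure)
  have "integrable M (\<lambda>t. \<Sum>h\<in>s ` space M. indicator {t \<in> space M. s t = h} t * \<phi> h)"
    using int by (intro Bochner_Integration.integrable_sum) auto
  then show "integrable M (\<lambda>t. \<phi> (s t))"
    using rep by (subst Bochner_Integration.integrable_cong[OF refl rep]) auto
  have "(\<integral>t. \<phi> (s t) \<partial>M) = (\<integral>t. (\<Sum>h\<in>s ` space M. indicator {t \<in> space M. s t = h} t * \<phi> h) \<partial>M)"
    using rep by (intro Bochner_Integration.integral_cong) auto
  also have "\<dots> = (\<Sum>h\<in>s ` space M. (\<integral>t. indicator {t \<in> space M. s t = h} t * \<phi> h \<partial>M))"
    using int by (intro Bochner_Integration.integral_sum) auto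
  also have "\<dots> = (\<Sum>h\<in>s ` space M. measure M {t \<in> space M. s t = h} * \<phi> h)"
  proof (intro sum.cong refl)
    fix h assume "h \<in> s ` space M"
    from meas[OF this] show "(\<integral>t. indicator {t \<in> space M. s t = h} t * \<phi> h \<partial>M) = measure M {t \<in> space M. s t = h} * \<phi> h"
      by (simp add: Int_absorb2 sets.sets_into_space)
  qed
  finally show "(\<integral>t. \<phi> (s t) \<partial>M) = (\<Sum>h\<in>s ` space M. measure M {t \<in> space M. s t = h} * \<phi> h)" .
qed

text \<open>Pairing with \<open>z\<close> commutes with the integral of the approximating simple functions, where it is a
  finite sum, and the Cauchy-Schwarz inequality bounds the errors by the two approximation errors in
  the definition of the Bochner integral.\<close>

lemma has_L2_bochner_integral_inner_le:
  assumes B: "has_L2_bochner_integral \<nu> M g J" and "finite_measure M" and z: "z \<in> L2_space \<nu>"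
    and K: "AE t in M. (\<integral>x. g t x * z x \<partial>\<nu>) \<le> K"
  shows "(\<integral>x. J x * z x \<partial>\<nu>) \<le> K * measure M (space M)"
proof -
  interpret finite_measure M by fact
  from B obtain s where J: "J \<in> L2_space \<nu>" and g: "AE t in M. g t \<in> L2_space \<nu>"
    and simple: "\<And>n. simple_function M (s n)" and s: "\<And>n t. t \<in> space M \<Longrightarrow> s n t \<in> L2_space \<nu>"
    and L1: "(\<lambda>n. \<integral>\<^sup>+t. ennreal (L2_dist \<nu> (s n t) (g t)) \<partial>M) \<longlonglongrightarrow> 0"
    and lim: "(\<lambda>n. L2_dist \<nu> (\<lambda>x. \<Sum>h\<in>s n ` space M. measure M {t \<in> space M. s n t = h} * h x) J) \<longlonglongrightarrow> 0"
    unfolding has_L2_bochner_integral_def by blast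
  define S where "S = (\<lambda>n x. \<Sum>h\<in>s n ` space M. measure M {t \<in> space M. s n t = h} * h x)"
  define F where "F = (\<lambda>n t. \<integral>x. s n t x * z x \<partial>\<nu>)"
  \<comment> \<open>Adding \<open>1\<close> keeps the divisor positive also for \<open>z = 0\<close>.\<close>
  define N where "N = L2_norm \<nu> z + 1"
  have N: "N > 0" "L2_norm \<nu> z \<le> N" using L2_norm_nonneg[of \<nu> z] by (auto simp: N_def simp del: L2_norm_nonneg)
  have fin: "finite (s n ` space M)" for n using simple[of n] by (simp add: simple_function_def)
  have S: "S n \<in> L2_space \<nu>" for n
    unfolding S_def using fin s by (intro L2_space_sum) auto
  have intF: "integrable M (F n)" for n
    unfolding F_def using simple_function_integral_eq_sum(1)[OF assms(2) simple, of "\<lambda>h. \<integral>x. h x * z x \<partial>\<nu>"] .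
  have SF: "(\<integral>x. S n x * z x \<partial>\<nu>) = (\<integral>t. F n t \<partial>M)" for n
  proof -
    have "(\<integral>x. S n x * z x \<partial>\<nu>) = (\<integral>x. (\<Sum>h\<in>s n ` space M. measure M {t \<in> space M. s n t = h} * (h x * z x)) \<partial>\<nu>)"
      by (simp add: S_def sum_distrib_right mult.assoc)
    also have "\<dots> = (\<Sum>h\<in>s n ` space M. \<integral>x. measure M {t \<in> space M. s n t = h} * (h x * z x) \<partial>\<nu>)"
      using s z by (intro Bochner_Integration.integral_sum integrable_mult_right L2_space_mult_integrable) auto
    also have "\<dots> = (\<Sum>h\<in>s n ` space M. measure M {t \<in> space M. s n t = h} * (\<integral>x. h x * z x \<partial>\<nu>))"
      by simp
    also have "\<dots> = (\<integral>t. F n t \<partial>M)"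
      unfolding F_def using simple_function_integral_eq_sum(2)[OF assms(2) simple, of "\<lambda>h. \<integral>x. h x * z x \<partial>\<nu>"] by simp
    finally show ?thesis .
  qed
  have inner_diff: "(\<integral>x. a x * z x \<partial>\<nu>) - (\<integral>x. b x * z x \<partial>\<nu>) \<le> L2_dist \<nu> a b * N"
    if "a \<in> L2_space \<nu>" "b \<in> L2_space \<nu>" for a b
  proof -
    have "(\<integral>x. a x * z x \<partial>\<nu>) - (\<integral>x. b x * z x \<partial>\<nu>) = (\<integral>x. (a x - b x) * z x \<partial>\<nu>)"
      using that z by (simp add: L2_space_mult_integrable left_diff_distrib)
    also have "\<dots> \<le> L2_dist \<nu> a b * L2_norm \<nu> z"
      using L2_Cauchy_Schwarz[OF L2_space_diff[OF that] z] by (simp add: L2_dist_eq_norm)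
    also have "\<dots> \<le> L2_dist \<nu> a b * N" using N by (intro mult_left_mono) (auto simp: L2_dist_eq_norm)
    finally show ?thesis .
  qed
  have "(\<integral>x. J x * z x \<partial>\<nu>) \<le> K * measure M (space M) + e" if "e > 0" for e
  proof -
    define d where "d = e / (2 * N)"
    have d: "d > 0" using N \<open>e > 0\<close> by (simp add: d_def)
    have "eventually (\<lambda>n. (\<integral>\<^sup>+t. ennreal (L2_dist \<nu> (s n t) (g t)) \<partial>M) < ennreal d \<and> L2_dist \<nu> (S n) J < d) sequentially"
      using order_tendstoD(2)[OF L1, of "ennreal d"] order_tendstoD(2)[OF lim[folded S_def], of d] d
      by (auto simp: S_def intro: eventually_conj)
    then obtain n where n: "(\<integral>\<^sup>+t. ennreal (L2_dist \<nu> (s n t) (g t)) \<partial>M) < ennreal d" "L2_dist \<nu> (S n) J < d"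
      by (auto dest!: eventually_happens'[OF sequentially_bot])
    \<comment> \<open>The factor \<open>N\<close> stays on the left because \<open>L2_dist\<close> of the simple functions to \<open>g\<close> is not known
      to be measurable, so constants cannot be moved out of its integral.\<close>
    have "AE t in M. (F n t - K) / N \<le> L2_dist \<nu> (s n t) (g t)"
      using g K AE_space
    proof eventually_elim
      case (elim t)
      have "F n t - K \<le> L2_dist \<nu> (s n t) (g t) * N"
        using inner_diff[OF s[OF elim(3)] elim(1), of n] elim(2) by (simp add: F_def)
      then show ?case using N by (simp add: divide_le_eq)
    qed
    then have "AE t in M. ennreal ((F n t - K) / N) \<le> ennreal (L2_dist \<nu> (s n t) (g t))"
      by eventually_elim (rule ennreal_leI)
    then have "(\<integral>\<^sup>+t. ennreal ((F n t - K) / N) \<partial>M) \<le> (\<integral>\<^sup>+t. ennreal (L2_dist \<nu> (s n t) (g t)) \<partial>M)"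
      by (rule nn_integral_mono_AE)
    also have "\<dots> \<le> ennreal d" using n by simp
    finally have "(\<integral>t. (F n t - K) / N \<partial>M) \<le> d"
      using d by (intro integral_real_bounded) auto
    then have "(\<integral>t. F n t \<partial>M) - K * measure M (space M) \<le> d * N"
      using intF[of n] N by (simp add: divide_le_eq mult.commute)
    moreover have "(\<integral>x. J x * z x \<partial>\<nu>) - (\<integral>x. S n x * z x \<partial>\<nu>) \<le> d * N"
    proof -
      have "L2_dist \<nu> J (S n) * N \<le> d * N" using n(2) N by (intro mult_right_mono) (auto simp: L2_dist_commute)
      then show ?thesis using inner_diff[OF J S[of n]] by simp
    qed
    moreover have "d * N + d * N = e" using N by (simp add: d_def)
    ultimately show ?thesis using SF[of n] by linarith
  qed
  then show ?thesis by (rule field_le_epsilon)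
qed

section \<open>Gradient flows of Lipschitz functionals\<close>

text \<open>\<open>- v\<^sub>t \<in> \<partial>E(v(t))\<close> in integrated form, at positive times only. The derivative \<open>g\<close> may depend on the
  interval, so no derivative on the whole half-line has to be pieced together.\<close>

locale lipschitz_gradient_flow =
  fixes \<nu> :: "'a measure" and E :: "('a \<Rightarrow> real) \<Rightarrow> real" and C :: real
    and v :: "real \<Rightarrow> 'a \<Rightarrow> real"
  assumes C_nonneg: "0 \<le> C"
    and lipschitz: "\<And>u w. u \<in> L2_space \<nu> \<Longrightarrow> w \<in> L2_space \<nu> \<Longrightarrow> E u \<le> E w + C * L2_dist \<nu> u w"
    and curve_in: "\<And>t. 0 < t \<Longrightarrow> v t \<in> L2_space \<nu>"
    and flow: "\<And>a b. 0 < a \<Longrightarrow> a \<le> b \<Longrightarrow> \<exists>g.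
      has_L2_bochner_integral \<nu> (lebesgue_on {a..b}) g (\<lambda>x. v b x - v a x) \<and>
      (AE s in lebesgue_on {a..b}. \<forall>w\<in>L2_space \<nu>. E (v s) - (\<integral>x. g s x * (w x - v s x) \<partial>\<nu>) \<le> E w)"
begin

text \<open>Moving from \<open>z\<close> in the direction \<open>- h\<close>, the energy can grow by at most \<open>C \<parallel>h\<parallel>\<close>. This is the
  dual form of \<open>\<parallel>g\<parallel> \<le> C\<close>.\<close>

lemma subgradient_inner_le:
  assumes "z \<in> L2_space \<nu>" "h \<in> L2_space \<nu>"
    and "\<forall>w\<in>L2_space \<nu>. E z - (\<integral>x. g x * (w x - z x) \<partial>\<nu>) \<le> E w"
  shows "(\<integral>x. g x * h x \<partial>\<nu>) \<le> C * L2_norm \<nu> h"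
proof -
  have w: "(\<lambda>x. z x - h x) \<in> L2_space \<nu>" using assms by (intro L2_space_diff)
  then have "E z + (\<integral>x. g x * h x \<partial>\<nu>) \<le> E (\<lambda>x. z x - h x)"
    using assms(3) by force
  also have "\<dots> \<le> E z + C * L2_norm \<nu> h"
    using lipschitz[OF w assms(1)] by (simp add: L2_dist_eq_norm L2_norm_def)
  finally show ?thesis by simp
qed

text \<open>The speed of the curve is a subgradient and hence at most \<open>C\<close>; the increment is tested against
  itself.\<close>

lemma curve_lipschitz:
  assumes "0 < a" "a \<le> b"
  shows "L2_dist \<nu> (v b) (v a) \<le> C * (b - a)"
proof -
  define h where "h = (\<lambda>x. v b x - v a x)"
  have h: "h \<in> L2_space \<nu>" unfolding h_def using assms by (intro L2_space_diff curve_in) auto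
  obtain g where B: "has_L2_bochner_integral \<nu> (lebesgue_on {a..b}) g h"
    and sub: "AE s in lebesgue_on {a..b}. \<forall>w\<in>L2_space \<nu>. E (v s) - (\<integral>x. g s x * (w x - v s x) \<partial>\<nu>) \<le> E w"
    using flow[OF assms] unfolding h_def by blast
  have "AE s in lebesgue_on {a..b}. (\<integral>x. g s x * h x \<partial>\<nu>) \<le> C * L2_norm \<nu> h"
    using sub AE_space
  proof eventually_elim
    case (elim s)
    then show ?case using assms h by (intro subgradient_inner_le[of "v s"] curve_in) auto
  qed
  from has_L2_bochner_integral_inner_le[OF B _ h this]
  have "(\<integral>x. h x * h x \<partial>\<nu>) \<le> C * L2_norm \<nu> h * (b - a)"
    using assms by (simp add: finite_measure_lebesgue_on measure_restrict_space)
  then have "L2_norm \<nu> h * L2_norm \<nu> h \<le> (C * (b - a)) * L2_norm \<nu> h"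
    by (simp flip: power2_eq_square add: L2_norm_square mult_ac)
  moreover have "0 \<le> C * (b - a)" using C_nonneg assms by simp
  ultimately have "L2_norm \<nu> h \<le> C * (b - a)"
    by (cases "L2_norm \<nu> h = 0") (auto simp: order.not_eq_order_implies_strict)
  then show ?thesis by (simp add: h_def L2_dist_eq_norm)
qed

text \<open>The subgradient at time \<open>s\<close> is tested against \<open>v s - w\<close>, but the increment of the squared distance
  involves \<open>v b - w\<close>. Replacing one by the other costs \<open>\<parallel>g s\<parallel> \<parallel>v b - v s\<parallel> \<le> C\<^sup>2 (b - a)\<close>, which is the
  error term.\<close>

lemma variational_inequality_one_step:
  assumes "0 < a" "a \<le> b" and w: "w \<in> L2_space \<nu>" and c: "\<And>s. s \<in> {a..b} \<Longrightarrow> c \<le> E (v s)"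
  shows "(L2_dist \<nu> (v b) w)\<^sup>2 - (L2_dist \<nu> (v a) w)\<^sup>2 \<le> 2 * (b - a) * (E w - c + C\<^sup>2 * (b - a))"
proof -
  define z where "z = (\<lambda>x. v b x - w x)"
  define K where "K = E w - c + C\<^sup>2 * (b - a)"
  have mem: "v a \<in> L2_space \<nu>" "v b \<in> L2_space \<nu>" using assms by (auto intro: curve_in)
  have z: "z \<in> L2_space \<nu>" unfolding z_def using mem w by (intro L2_space_diff) auto
  obtain g where B: "has_L2_bochner_integral \<nu> (lebesgue_on {a..b}) g (\<lambda>x. v b x - v a x)"
    and sub: "AE s in lebesgue_on {a..b}. \<forall>w\<in>L2_space \<nu>. E (v s) - (\<integral>x. g s x * (w x - v s x) \<partial>\<nu>) \<le> E w"
    using flow[OF assms(1,2)] by blast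
  have "AE s in lebesgue_on {a..b}. g s \<in> L2_space \<nu>"
    using B by (simp add: has_L2_bochner_integral_def)
  then have "AE s in lebesgue_on {a..b}. (\<integral>x. g s x * z x \<partial>\<nu>) \<le> K"
    using sub AE_space
  proof eventually_elim
    case (elim s)
    then have s: "s \<in> {a..b}" by simp
    have vs: "v s \<in> L2_space \<nu>" using s assms by (intro curve_in) auto
    have d: "(\<lambda>x. v b x - v s x) \<in> L2_space \<nu>" "(\<lambda>x. w x - v s x) \<in> L2_space \<nu>"
      using vs mem w by (auto intro: L2_space_diff)
    have "(\<integral>x. g s x * z x \<partial>\<nu>) = (\<integral>x. g s x * (v b x - v s x) - g s x * (w x - v s x) \<partial>\<nu>)"
      by (simp add: z_def algebra_simps)
    also have "\<dots> = (\<integral>x. g s x * (v b x - v s x) \<partial>\<nu>) - (\<integral>x. g s x * (w x - v s x) \<partial>\<nu>)"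
      using d elim(1) by (intro Bochner_Integration.integral_diff L2_space_mult_integrable)
    also have "\<dots> \<le> C * L2_norm \<nu> (\<lambda>x. v b x - v s x) + (E w - E (v s))"
      using subgradient_inner_le[OF vs d(1) elim(2)] elim(2)[rule_format, OF w] by simp
    also have "\<dots> \<le> C * (C * (b - a)) + (E w - c)"
    proof (intro add_mono mult_left_mono diff_left_mono)
      have "L2_norm \<nu> (\<lambda>x. v b x - v s x) \<le> C * (b - s)"
        using curve_lipschitz[of s b] s assms by (simp add: L2_dist_eq_norm)
      also have "\<dots> \<le> C * (b - a)" using s C_nonneg by (intro mult_left_mono) auto
      finally show "L2_norm \<nu> (\<lambda>x. v b x - v s x) \<le> C * (b - a)" .
    qed (use c s C_nonneg in auto)
    also have "\<dots> = K" by (simp add: K_def power2_eq_square)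
    finally show ?case .
  qed
  from has_L2_bochner_integral_inner_le[OF B _ z this]
  have "(\<integral>x. (v b x - v a x) * z x \<partial>\<nu>) \<le> K * (b - a)"
    using assms by (simp add: finite_measure_lebesgue_on measure_restrict_space)
  then have "2 * (\<integral>x. (v b x - v a x) * z x \<partial>\<nu>) \<le> 2 * (b - a) * K" by (simp add: algebra_simps)
  moreover have "0 \<le> (L2_dist \<nu> (v b) (v a))\<^sup>2" by simp
  ultimately show ?thesis
    using L2_dist_square_diff[OF mem(2,1) w] unfolding z_def K_def by linarith
qed

text \<open>Over \<open>N\<close> equal steps the errors of the one-step inequality, each quadratic in the step length, add up
  to \<open>O(1/N)\<close>.\<close>

lemma variational_inequality:
  assumes "0 < a" "a \<le> b" and w: "w \<in> L2_space \<nu>" and c: "\<And>s. s \<in> {a..b} \<Longrightarrow> c \<le> E (v s)"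
  shows "(L2_dist \<nu> (v b) w)\<^sup>2 - (L2_dist \<nu> (v a) w)\<^sup>2 \<le> 2 * (b - a) * (E w - c)"
proof -
  have approx: "(L2_dist \<nu> (v b) w)\<^sup>2 - (L2_dist \<nu> (v a) w)\<^sup>2
      \<le> 2 * (b - a) * (E w - c) + 2 * C\<^sup>2 * (b - a)\<^sup>2 / real (Suc N)" for N
  proof -
    define h where "h = (b - a) / real (Suc N)"
    have h: "0 \<le> h" "real (Suc N) * h = b - a" using assms by (auto simp: h_def)
    have "(L2_dist \<nu> (v (a + real i * h)) w)\<^sup>2 - (L2_dist \<nu> (v a) w)\<^sup>2
        \<le> real i * (2 * h * (E w - c + C\<^sup>2 * h))" if "i \<le> Suc N" for i
      using that
    proof (induction i)
      case 0
      then show ?case by simp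
    next
      case (Suc i)
      have step: "a + real (Suc i) * h = a + real i * h + h" by (simp add: algebra_simps)
      have "real (Suc i) * h \<le> real (Suc N) * h" using Suc.prems h by (intro mult_right_mono) auto
      then have le: "a + real i * h + h \<le> b" using h step by simp
      have "0 \<le> real i * h" using h by simp
      then have pos: "0 < a + real i * h" and sub: "{a + real i * h..a + real i * h + h} \<subseteq> {a..b}"
        using assms(1) le by auto
      have "(L2_dist \<nu> (v (a + real i * h + h)) w)\<^sup>2 - (L2_dist \<nu> (v (a + real i * h)) w)\<^sup>2
          \<le> 2 * h * (E w - c + C\<^sup>2 * h)"
        using variational_inequality_one_step[OF pos _ w c[OF subsetD[OF sub]], of "a + real i * h + h"] h
        by simp
      with Suc show ?case unfolding step by (simp add: algebra_simps)
    qed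
    from this[of "Suc N"] have "(L2_dist \<nu> (v b) w)\<^sup>2 - (L2_dist \<nu> (v a) w)\<^sup>2
        \<le> real (Suc N) * (2 * h * (E w - c + C\<^sup>2 * h))" using h by simp
    also have "\<dots> = 2 * (real (Suc N) * h) * (E w - c) + 2 * C\<^sup>2 * (real (Suc N) * h) * h"
      by (simp add: algebra_simps)
    also have "\<dots> = 2 * (b - a) * (E w - c) + 2 * C\<^sup>2 * (b - a)\<^sup>2 / real (Suc N)"
      unfolding h(2) by (simp add: h_def power2_eq_square)
    finally show ?thesis .
  qed
  have "(\<lambda>N. 2 * C\<^sup>2 * (b - a)\<^sup>2 / real (Suc N)) \<longlonglongrightarrow> 0"
    by (rule LIMSEQ_Suc[OF lim_const_over_n])
  then have "(\<lambda>N. 2 * (b - a) * (E w - c) + 2 * C\<^sup>2 * (b - a)\<^sup>2 / real (Suc N))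
      \<longlonglongrightarrow> 2 * (b - a) * (E w - c) + 0"
    by (rule tendsto_add[OF tendsto_const])
  from LIMSEQ_le_const[OF this, of "(L2_dist \<nu> (v b) w)\<^sup>2 - (L2_dist \<nu> (v a) w)\<^sup>2"] approx
  show ?thesis by auto
qed

lemma energy_lipschitz_along_curve:
  assumes "0 < s" "0 < t"
  shows "\<bar>E (v s) - E (v t)\<bar> \<le> C\<^sup>2 * \<bar>s - t\<bar>"
proof -
  have "L2_dist \<nu> (v s) (v t) \<le> C * \<bar>s - t\<bar>"
    using curve_lipschitz[of s t] curve_lipschitz[of t s] assms
    by (cases "s \<le> t") (auto simp: L2_dist_commute)
  then have "C * L2_dist \<nu> (v s) (v t) \<le> C\<^sup>2 * \<bar>s - t\<bar>"
    using mult_left_mono[OF _ C_nonneg] by (simp add: power2_eq_square mult.assoc)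
  then show ?thesis
    using lipschitz[OF curve_in curve_in, OF assms] lipschitz[OF curve_in curve_in, OF assms(2,1)]
    by (simp add: L2_dist_commute abs_le_iff)
qed

text \<open>If the energy were larger at \<open>b\<close> than at \<open>a\<close>, let \<open>p\<close> be the last time in \<open>[a, b]\<close> at which it is at
  most its value at \<open>a\<close>. From \<open>p\<close> on the energy stays above \<open>E (v p)\<close>, so the variational inequality with
  \<open>w = v p\<close> forces \<open>v b = v p\<close>.\<close>

lemma energy_antimono:
  assumes "0 < a" "a \<le> b"
  shows "E (v b) \<le> E (v a)"
proof (rule ccontr)
  assume neg: "\<not> E (v b) \<le> E (v a)"
  have cont: "continuous_on {a..b} (\<lambda>s. E (v s))"
  proof (rule continuous_onI)
    fix s e :: real assume s: "s \<in> {a..b}" and "e > 0"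
    have C: "0 < C\<^sup>2 + 1" by (simp add: add_nonneg_pos)
    have "dist (E (v t)) (E (v s)) \<le> e" if "t \<in> {a..b}" "dist t s < e / (C\<^sup>2 + 1)" for t
    proof -
      have "\<bar>E (v t) - E (v s)\<bar> \<le> C\<^sup>2 * \<bar>t - s\<bar>"
        using energy_lipschitz_along_curve[of t s] that s assms by auto
      also have "\<dots> \<le> (C\<^sup>2 + 1) * \<bar>t - s\<bar>" by (intro mult_right_mono) auto
      also have "\<dots> \<le> e" using that C by (simp add: dist_real_def field_simps)
      finally show ?thesis by (simp add: dist_real_def)
    qed
    then show "\<exists>d>0. \<forall>t\<in>{a..b}. dist t s < d \<longrightarrow> dist (E (v t)) (E (v s)) \<le> e"
      using C \<open>e > 0\<close> by (intro exI[of _ "e / (C\<^sup>2 + 1)"]) auto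
  qed
  define S where "S = {s \<in> {a..b}. E (v s) \<le> E (v a)}"
  have "closed S" unfolding S_def using cont by (intro continuous_on_closed_Collect_le continuous_on_const) auto
  moreover have "a \<in> S" "bdd_above S" using assms by (auto simp: S_def intro!: bdd_aboveI[of _ b])
  ultimately have "Sup S \<in> S" by (intro closed_contains_Sup) auto
  define p where "p = Sup S"
  have p: "p \<in> {a..b}" "E (v p) \<le> E (v a)" using \<open>Sup S \<in> S\<close> by (auto simp: S_def p_def)
  have "E (v p) \<le> E (v s)" if "s \<in> {p..b}" for s
  proof (cases "s \<in> S")
    case True
    then have "s \<le> p" unfolding p_def using \<open>bdd_above S\<close> by (intro cSup_upper)
    then show ?thesis using that by simp
  next
    case False
    then show ?thesis using that p by (auto simp: S_def)
  qed
  moreover have "0 < p" using p assms by simp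
  ultimately have "(L2_dist \<nu> (v b) (v p))\<^sup>2 - (L2_dist \<nu> (v p) (v p))\<^sup>2 \<le> 2 * (b - p) * (E (v p) - E (v p))"
    using p by (intro variational_inequality curve_in) auto
  moreover have "L2_dist \<nu> (v p) (v p) = 0" by (simp add: L2_dist_def)
  ultimately have "L2_dist \<nu> (v b) (v p) = 0" by simp
  then have "E (v b) \<le> E (v p)"
    using lipschitz[of "v b" "v p"] curve_in \<open>0 < p\<close> assms by auto
  with p neg show False by simp
qed

text \<open>The energy is nonincreasing along the curve, and \<open>E u\<close> is its limit along a sequence of times.\<close>

lemma energy_omega_limit_le:
  assumes "u \<in> omega_limit \<nu> v" "0 < t"
  shows "E u \<le> E (v t)"
proof -
  obtain \<tau> where u: "u \<in> L2_space \<nu>" and \<tau>: "filterlim \<tau> at_top sequentially"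
    and lim: "(\<lambda>n. L2_dist \<nu> (v (\<tau> n)) u) \<longlonglongrightarrow> 0"
    using assms(1) by (auto simp: omega_limit_def)
  have "(\<lambda>n. E (v t) + C * L2_dist \<nu> (v (\<tau> n)) u) \<longlonglongrightarrow> E (v t) + C * 0"
    by (intro tendsto_intros lim)
  moreover have "\<forall>\<^sub>F n in sequentially. E u \<le> E (v t) + C * L2_dist \<nu> (v (\<tau> n)) u"
    using filterlim_at_top[THEN iffD1, OF \<tau>, rule_format, of t]
  proof eventually_elim
    case (elim n)
    have "E u \<le> E (v (\<tau> n)) + C * L2_dist \<nu> (v (\<tau> n)) u"
      using lipschitz[OF u curve_in, of "\<tau> n"] elim assms(2) by (simp add: L2_dist_commute)
    then show ?case using energy_antimono[OF assms(2) elim] by simp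
  qed
  ultimately show ?thesis
    using tendsto_lowerbound[of _ "E (v t) + C * 0" sequentially "E u"] by simp
qed

text \<open>A competitor \<open>w\<close> of smaller energy would attract the curve forever: \<open>\<parallel>v b - w\<parallel>\<^sup>2\<close> decreases at least
  at the rate \<open>2 (E u - E w)\<close> and would become negative.\<close>

lemma omega_limit_minimizes:
  assumes "u \<in> omega_limit \<nu> v" "w \<in> L2_space \<nu>"
  shows "E u \<le> E w"
proof (rule ccontr)
  assume "\<not> E u \<le> E w"
  then have gap: "E u - E w > 0" by simp
  define D where "D = (L2_dist \<nu> (v 1) w)\<^sup>2"
  \<comment> \<open>The time after time \<open>1\<close> at which the bound on the squared distance reaches \<open>- 1\<close>.\<close>
  define b where "b = 1 + (D + 1) / (2 * (E u - E w))"
  have "D \<ge> 0" by (simp add: D_def)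
  then have b: "1 \<le> b" using gap by (simp add: b_def)
  have "(L2_dist \<nu> (v b) w)\<^sup>2 - D \<le> 2 * (b - 1) * (E w - E u)"
    unfolding D_def using b assms
    by (intro variational_inequality energy_omega_limit_le) auto
  also have "\<dots> = - (D + 1)" using gap by (simp add: b_def field_simps)
  finally show False using zero_le_power2[of "L2_dist \<nu> (v b) w"] by linarith
qed

text \<open>As \<open>E u\<close> is a lower bound of the energy along the curve, \<open>\<parallel>v t - u\<parallel>\<close> is nonincreasing; along some
  sequence it tends to \<open>0\<close>.\<close>

lemma converges_to_omega_limit:
  assumes u: "u \<in> omega_limit \<nu> v"
  shows "((\<lambda>t. L2_dist \<nu> (v t) u) \<longlongrightarrow> 0) at_top"
proof (rule tendstoI)
  fix e :: real assume "e > 0"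
  obtain \<tau> where uL: "u \<in> L2_space \<nu>" and \<tau>: "filterlim \<tau> at_top sequentially"
    and lim: "(\<lambda>n. L2_dist \<nu> (v (\<tau> n)) u) \<longlonglongrightarrow> 0"
    using u by (auto simp: omega_limit_def)
  have "\<forall>\<^sub>F n in sequentially. 1 \<le> \<tau> n \<and> L2_dist \<nu> (v (\<tau> n)) u < e"
    using filterlim_at_top[THEN iffD1, OF \<tau>, rule_format, of 1] order_tendstoD(2)[OF lim \<open>e > 0\<close>]
    by (rule eventually_conj)
  then obtain n where n: "1 \<le> \<tau> n" "L2_dist \<nu> (v (\<tau> n)) u < e"
    by (auto dest!: eventually_happens'[OF sequentially_bot])
  have "L2_dist \<nu> (v t) u < e" if "\<tau> n \<le> t" for t
  proof -
    have "(L2_dist \<nu> (v t) u)\<^sup>2 - (L2_dist \<nu> (v (\<tau> n)) u)\<^sup>2 \<le> 2 * (t - \<tau> n) * (E u - E u)"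
      using n that uL u by (intro variational_inequality energy_omega_limit_le) auto
    then have "L2_dist \<nu> (v t) u \<le> L2_dist \<nu> (v (\<tau> n)) u"
      by (auto intro: power2_le_imp_le)
    with n show ?thesis by simp
  qed
  then show "\<forall>\<^sub>F t in at_top. dist (L2_dist \<nu> (v t) u) 0 < e"
    by (auto simp: dist_real_def eventually_at_top_linorder)
qed

end


section \<open>Invariance and total variation\<close>

locale reversible_random_walk = finite_measure \<nu>
  for \<nu> :: "'a::polish_space measure" +
  fixes m :: "'a \<Rightarrow> 'a measure"
  assumes walk: "random_walk m" and sets_eq [measurable_cong, simp]: "sets \<nu> = sets borel"
    and rev: "reversible m \<nu>"
begin

lemma space_eq [simp]: "space \<nu> = UNIV"
  using sets_eq_imp_space_eq[OF sets_eq] by simp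

lemma borel_measurable_eq: "borel_measurable \<nu> = borel_measurable borel"
  by (intro measurable_cong_sets) auto

lemma
  shows sets_kernel [simp]: "sets (m x) = sets borel"
    and prob_space_kernel: "prob_space (m x)"
    and space_kernel [simp]: "space (m x) = UNIV"
    and emeasure_kernel_UNIV [simp]: "emeasure (m x) UNIV = 1"
proof -
  show s: "sets (m x) = sets borel" and p: "prob_space (m x)"
    using walk by (auto simp: random_walk_def)
  show sp: "space (m x) = UNIV" using sets_eq_imp_space_eq[OF s] by simp
  show "emeasure (m x) UNIV = 1" using prob_space.emeasure_space_1[OF p] sp by simp
qed

lemma measurable_kernel [measurable]: "m \<in> borel \<rightarrow>\<^sub>M subprob_algebra borel"
proof (rule measurable_subprob_algebra)
  fix A :: "'a set" assume A: "A \<in> sets borel"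
  have "(\<lambda>x. ennreal (measure (m x) A)) \<in> borel_measurable borel"
    using walk A by (auto simp: random_walk_def)
  also have "(\<lambda>x. ennreal (measure (m x) A)) = (\<lambda>x. emeasure (m x) A)"
    using prob_space_kernel by (simp add: finite_measure.emeasure_eq_measure prob_space_def)
  finally show "(\<lambda>x. emeasure (m x) A) \<in> borel_measurable borel" .
qed (auto simp: prob_space_kernel prob_space_imp_subprob_space)

lemma measurable_kernel_integral [measurable]:
  assumes [measurable]: "u \<in> borel_measurable borel"
  shows "(\<lambda>x. \<integral>\<^sup>+y. ennreal \<bar>u y - u x\<bar> \<partial>m x) \<in> borel_measurable borel"
  by (rule nn_integral_measurable_subprob_algebra2[OF _ measurable_kernel]) measurable

text \<open>Reversibility on the sets \<open>X \<times> A\<close> says that \<open>\<integral> m\<^sub>x(A) d\<nu>(x) = \<nu>(A)\<close>, that is, \<open>\<nu>\<close> composed with the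
  kernel \<open>m\<close> is \<open>\<nu>\<close> again.\<close>

lemma invariance:
  assumes h: "h \<in> borel_measurable borel"
  shows "(\<integral>\<^sup>+x. \<integral>\<^sup>+y. h y \<partial>m x \<partial>\<nu>) = (\<integral>\<^sup>+x. h x \<partial>\<nu>)"
proof -
  have m: "m \<in> \<nu> \<rightarrow>\<^sub>M subprob_algebra borel"
    using measurable_kernel by (simp cong: measurable_cong_sets)
  have "\<nu> \<bind> m = \<nu>"
  proof (rule measure_eqI)
    show "sets (\<nu> \<bind> m) = sets \<nu>" by (subst sets_bind[where N = borel]) auto
    fix A assume "A \<in> sets (\<nu> \<bind> m)"
    then have A: "A \<in> sets borel" by (subst (asm) sets_bind[where N = borel]) auto
    have C: "UNIV \<times> A \<in> sets (borel :: ('a \<times> 'a) measure)"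
      using A by (subst borel_prod[symmetric]) auto
    have "emeasure (\<nu> \<bind> m) A = (\<integral>\<^sup>+x. emeasure (m x) A \<partial>\<nu>)"
      using A by (intro emeasure_bind[OF _ m]) auto
    also have "\<dots> = (\<integral>\<^sup>+y. emeasure (m y) {x. (x, y) \<in> UNIV \<times> A} \<partial>\<nu>)"
      using rev[unfolded reversible_def, rule_format, OF C] by simp
    also have "\<dots> = (\<integral>\<^sup>+y. indicator A y \<partial>\<nu>)"
      by (intro nn_integral_cong) (auto simp: indicator_def)
    also have "\<dots> = emeasure \<nu> A" using A by simp
    finally show "emeasure (\<nu> \<bind> m) A = emeasure \<nu> A" .
  qed
  then show ?thesis using nn_integral_bind[OF h m] by simp
qed

text \<open>With \<open>d = |u - w|\<close>, the triangle inequality gives \<open>|u y - u x| \<le> |w y - w x| + d y + d x\<close>. By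
  invariance \<open>d y\<close> and \<open>d x\<close> have the same integral \<open>\<parallel>u - w\<parallel>\<^sub>1\<close>, and the factor \<open>1/2\<close> compensates for
  having two of them.\<close>

lemma TV_le_TV_plus_L1:
  assumes "u \<in> borel_measurable borel" "w \<in> borel_measurable borel"
  shows "TV m \<nu> u \<le> TV m \<nu> w + (\<integral>\<^sup>+x. ennreal \<bar>u x - w x\<bar> \<partial>\<nu>)"
proof -
  note [measurable] = assms
  define d where "d = (\<lambda>x. ennreal \<bar>u x - w x\<bar>)"
  have [measurable]: "d \<in> borel_measurable borel" unfolding d_def by measurable
  have d\<nu>: "d \<in> borel_measurable \<nu>" by (simp add: borel_measurable_eq)
  have "(\<integral>\<^sup>+y. ennreal \<bar>u y - u x\<bar> \<partial>m x) \<le> (\<integral>\<^sup>+y. ennreal \<bar>w y - w x\<bar> \<partial>m x) + (\<integral>\<^sup>+y. d y \<partial>m x) + d x" for x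
  proof -
    have "(\<integral>\<^sup>+y. ennreal \<bar>u y - u x\<bar> \<partial>m x) \<le> (\<integral>\<^sup>+y. ennreal \<bar>w y - w x\<bar> + d y + d x \<partial>m x)"
      by (intro nn_integral_mono) (simp add: d_def flip: ennreal_plus)
    also have "\<dots> = (\<integral>\<^sup>+y. ennreal \<bar>w y - w x\<bar> \<partial>m x) + (\<integral>\<^sup>+y. d y \<partial>m x) + d x"
      by (simp add: nn_integral_add)
    finally show ?thesis .
  qed
  then have "(\<integral>\<^sup>+x. \<integral>\<^sup>+y. ennreal \<bar>u y - u x\<bar> \<partial>m x \<partial>\<nu>)
      \<le> (\<integral>\<^sup>+x. (\<integral>\<^sup>+y. ennreal \<bar>w y - w x\<bar> \<partial>m x) + (\<integral>\<^sup>+y. d y \<partial>m x) + d x \<partial>\<nu>)"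
    by (intro nn_integral_mono)
  also have "\<dots> = (\<integral>\<^sup>+x. \<integral>\<^sup>+y. ennreal \<bar>w y - w x\<bar> \<partial>m x \<partial>\<nu>) + (\<integral>\<^sup>+x. \<integral>\<^sup>+y. d y \<partial>m x \<partial>\<nu>) + (\<integral>\<^sup>+x. d x \<partial>\<nu>)"
    by (simp add: nn_integral_add borel_measurable_eq)
  also have "\<dots> = (\<integral>\<^sup>+x. \<integral>\<^sup>+y. ennreal \<bar>w y - w x\<bar> \<partial>m x \<partial>\<nu>) + 2 * (\<integral>\<^sup>+x. d x \<partial>\<nu>)"
    by (simp add: invariance mult_2 add.assoc)
  finally have "TV m \<nu> u \<le> ennreal (1/2) * ((\<integral>\<^sup>+x. \<integral>\<^sup>+y. ennreal \<bar>w y - w x\<bar> \<partial>m x \<partial>\<nu>) + 2 * (\<integral>\<^sup>+x. d x \<partial>\<nu>))"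
    unfolding TV_def by (rule mult_left_mono) simp
  also have "\<dots> = TV m \<nu> w + ennreal (1/2) * 2 * (\<integral>\<^sup>+x. d x \<partial>\<nu>)"
    by (simp add: TV_def distrib_left mult.assoc)
  also have "ennreal (1/2) * 2 = 1"
    by (metis ennreal_1 ennreal_mult'' ennreal_numeral field_sum_of_halves mult_2_right zero_le_numeral)
  finally show ?thesis by (simp add: d_def)
qed

lemma integrable_measurable: "integrable \<nu> u \<Longrightarrow> u \<in> borel_measurable borel"
  using borel_measurable_integrable[of \<nu> u] by (simp add: borel_measurable_eq)

lemma nn_integral_L1_distance:
  fixes u w :: "'a \<Rightarrow> real"
  assumes "integrable \<nu> u" "integrable \<nu> w"
  shows "(\<integral>\<^sup>+x. ennreal \<bar>u x - w x\<bar> \<partial>\<nu>) = ennreal (\<integral>x. \<bar>u x - w x\<bar> \<partial>\<nu>)"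
  using assms by (intro nn_integral_eq_integral) auto

lemma TV_finite:
  assumes "integrable \<nu> u"
  shows "TV m \<nu> u < \<infinity>"
proof -
  have "TV m \<nu> u \<le> TV m \<nu> (\<lambda>_. 0) + (\<integral>\<^sup>+x. ennreal \<bar>u x - 0\<bar> \<partial>\<nu>)"
    using assms by (intro TV_le_TV_plus_L1 integrable_measurable) auto
  also have "\<dots> = ennreal (\<integral>x. \<bar>u x\<bar> \<partial>\<nu>)"
    using nn_integral_L1_distance[of u "\<lambda>_. 0"] assms by (simp add: TV_def)
  also have "\<dots> < \<infinity>" by simp
  finally show ?thesis .
qed

lemma L2_space_integrable: "u \<in> L2_space \<nu> \<Longrightarrow> integrable \<nu> u"
  by (rule square_integrable_imp_integrable[OF L2_space_measurable L2_space_square_integrable])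

lemma L1_le_L2:
  assumes "u \<in> L2_space \<nu>" "w \<in> L2_space \<nu>"
  shows "(\<integral>x. \<bar>u x - w x\<bar> \<partial>\<nu>) \<le> sqrt (measure \<nu> UNIV) * L2_dist \<nu> u w"
proof -
  define h where "h = (\<lambda>x. \<bar>u x - w x\<bar>)"
  have "h \<in> L2_space \<nu>" using L2_space_diff[OF assms] by (auto simp: h_def L2_space_def)
  moreover have "(\<lambda>_. 1) \<in> L2_space \<nu>" by (simp add: L2_space_def)
  ultimately have "\<bar>\<integral>x. h x * 1 \<partial>\<nu>\<bar> \<le> L2_norm \<nu> h * L2_norm \<nu> (\<lambda>_. 1)"
    by (rule L2_Cauchy_Schwarz)
  then show ?thesis
    by (simp add: h_def L2_norm_def L2_dist_def mult.commute)
qed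

end


section \<open>The energy and its gradient flow\<close>

lemma AE_lebesgue_on_subset:
  assumes "AE t in lebesgue_on S. P t" "A \<subseteq> S" "S \<in> sets lebesgue" "A \<in> sets lebesgue"
  shows "AE t in lebesgue_on A. P t"
  using assms by (subst (asm) AE_restrict_space_iff, simp, subst AE_restrict_space_iff) (auto elim!: AE_mp)

locale walk_energy = reversible_random_walk \<nu> m
  for \<nu> :: "'a::polish_space measure" and m +
  fixes f :: "'a \<Rightarrow> real" and l :: real
  assumes f: "integrable \<nu> f" and l: "0 \<le> l"
begin

text \<open>The energy as a real number; on \<open>L\<^sup>1\<close> it is finite and agrees with \<open>energy\<close>.\<close>

definition J :: "('a \<Rightarrow> real) \<Rightarrow> real" where
  "J u = enn2real (TV m \<nu> u) + l * (\<integral>x. \<bar>u x - f x\<bar> \<partial>\<nu>)"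

lemma energy_eq_J:
  assumes "integrable \<nu> u"
  shows "energy m \<nu> f l u = ennreal (J u)"
proof -
  have "energy m \<nu> f l u = ennreal (enn2real (TV m \<nu> u)) + ennreal (l * (\<integral>x. \<bar>u x - f x\<bar> \<partial>\<nu>))"
    using TV_finite[OF assms] nn_integral_L1_distance[OF assms f] l
    by (simp add: energy_def ennreal_mult)
  also have "\<dots> = ennreal (J u)"
    using l by (simp add: J_def ennreal_plus)
  finally show ?thesis .
qed

lemma J_lipschitz_L1:
  assumes "integrable \<nu> u" "integrable \<nu> w"
  shows "J u \<le> J w + (1 + l) * (\<integral>x. \<bar>u x - w x\<bar> \<partial>\<nu>)"
proof -
  have "ennreal (enn2real (TV m \<nu> u)) \<le> ennreal (enn2real (TV m \<nu> w) + (\<integral>x. \<bar>u x - w x\<bar> \<partial>\<nu>))"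
    using TV_le_TV_plus_L1[of u w] assms TV_finite nn_integral_L1_distance
    by (simp add: integrable_measurable ennreal_plus)
  then have TV: "enn2real (TV m \<nu> u) \<le> enn2real (TV m \<nu> w) + (\<integral>x. \<bar>u x - w x\<bar> \<partial>\<nu>)"
    by (subst (asm) ennreal_le_iff) auto
  have "(\<integral>x. \<bar>u x - f x\<bar> \<partial>\<nu>) \<le> (\<integral>x. \<bar>w x - f x\<bar> + \<bar>u x - w x\<bar> \<partial>\<nu>)"
    using assms f by (intro integral_mono) auto
  also have "\<dots> = (\<integral>x. \<bar>w x - f x\<bar> \<partial>\<nu>) + (\<integral>x. \<bar>u x - w x\<bar> \<partial>\<nu>)"
    using assms f by simp
  finally have "l * (\<integral>x. \<bar>u x - f x\<bar> \<partial>\<nu>) \<le> l * ((\<integral>x. \<bar>w x - f x\<bar> \<partial>\<nu>) + (\<integral>x. \<bar>u x - w x\<bar> \<partial>\<nu>))"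
    using l by (rule mult_left_mono)
  with TV show ?thesis by (simp add: J_def algebra_simps)
qed

lemma J_lipschitz_L2:
  assumes "u \<in> L2_space \<nu>" "w \<in> L2_space \<nu>"
  shows "J u \<le> J w + (1 + l) * sqrt (measure \<nu> UNIV) * L2_dist \<nu> u w"
proof -
  have "(1 + l) * (\<integral>x. \<bar>u x - w x\<bar> \<partial>\<nu>) \<le> (1 + l) * (sqrt (measure \<nu> UNIV) * L2_dist \<nu> u w)"
    using L1_le_L2[OF assms] l by (intro mult_left_mono) auto
  then show ?thesis
    using J_lipschitz_L1[OF assms[THEN L2_space_integrable]] by (simp add: mult.assoc)
qed

text \<open>The subgradient inequality \<open>|u - f| + \<xi> (w - u) \<le> |w - f|\<close> of the absolute value, integrated and added
  to that of the total variation: the terms with \<open>\<xi>\<close> cancel.\<close>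

lemma J_subgradient:
  assumes \<xi>: "\<xi> \<in> sign_graph \<nu> (\<lambda>x. u x - f x)" and lap: "(\<lambda>x. l * \<xi> x + g x) \<in> Laplacian1 m \<nu> u"
    and w: "w \<in> L2_space \<nu>"
  shows "J u - (\<integral>x. g x * (w x - u x) \<partial>\<nu>) \<le> J w"
proof -
  define d where "d = (\<lambda>x. w x - u x)"
  from lap have u: "u \<in> L2_space \<nu>" and p: "(\<lambda>x. l * \<xi> x + g x) \<in> L2_space \<nu>"
    and sub: "enn2ereal (TV m \<nu> w) \<ge> enn2ereal (TV m \<nu> u) + ereal (- (\<integral>x. (l * \<xi> x + g x) * d x \<partial>\<nu>))"
    using w by (auto simp: Laplacian1_def L2_subdifferential_def d_def)
  note int = u[THEN L2_space_integrable] w[THEN L2_space_integrable]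
  have d: "d \<in> L2_space \<nu>" unfolding d_def using u w by (intro L2_space_diff)
  have fin: "TV m \<nu> z \<noteq> \<infinity>" if "integrable \<nu> z" for z using TV_finite[OF that] by simp
  have TV: "enn2real (TV m \<nu> u) - (\<integral>x. (l * \<xi> x + g x) * d x \<partial>\<nu>) \<le> enn2real (TV m \<nu> w)"
  proof -
    have "enn2ereal (TV m \<nu> z) = ereal (enn2real (TV m \<nu> z))" if "integrable \<nu> z" for z
      using fin[OF that] by (cases "TV m \<nu> z") auto
    with int sub show ?thesis by simp
  qed
  have \<xi>_meas: "\<xi> \<in> borel_measurable \<nu>" and \<xi>_AE: "AE x in \<nu>. (u x - f x > 0 \<longrightarrow> \<xi> x = 1) \<and>
      (u x - f x < 0 \<longrightarrow> \<xi> x = -1) \<and> (u x - f x = 0 \<longrightarrow> \<xi> x \<in> {-1..1})"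
    using \<xi> by (auto simp: sign_graph_def)
  have bd: "AE x in \<nu>. \<bar>\<xi> x\<bar> \<le> 1"
    using \<xi>_AE
  proof eventually_elim
    case (elim x)
    then show ?case by (cases "u x - f x" "0 :: real" rule: linorder_cases) auto
  qed
  have int\<xi>: "integrable \<nu> (\<lambda>x. \<xi> x * d x)"
  proof (rule Bochner_Integration.integrable_bound)
    show "integrable \<nu> d" using d by (rule L2_space_integrable)
    then show "(\<lambda>x. \<xi> x * d x) \<in> borel_measurable \<nu>" using \<xi>_meas by auto
    show "AE x in \<nu>. norm (\<xi> x * d x) \<le> norm (d x)"
      using bd by eventually_elim (simp add: abs_mult mult_left_le_one_le)
  qed
  have "AE x in \<nu>. \<bar>u x - f x\<bar> + \<xi> x * d x \<le> \<bar>w x - f x\<bar>"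
    using \<xi>_AE bd
  proof eventually_elim
    case (elim x)
    have "\<bar>u x - f x\<bar> = \<xi> x * (u x - f x)"
      using elim(1) by (cases "u x - f x" "0 :: real" rule: linorder_cases) auto
    then have "\<bar>u x - f x\<bar> + \<xi> x * d x = \<xi> x * (w x - f x)" by (simp add: d_def algebra_simps)
    also have "\<dots> \<le> \<bar>\<xi> x\<bar> * \<bar>w x - f x\<bar>" by (simp flip: abs_mult)
    also have "\<dots> \<le> \<bar>w x - f x\<bar>" using elim(2) by (intro mult_left_le_one_le) auto
    finally show ?case .
  qed
  then have "(\<integral>x. \<bar>u x - f x\<bar> + \<xi> x * d x \<partial>\<nu>) \<le> (\<integral>x. \<bar>w x - f x\<bar> \<partial>\<nu>)"
    using int int\<xi> f by (intro integral_mono_AE) auto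
  then have fid: "l * (\<integral>x. \<bar>u x - f x\<bar> \<partial>\<nu>) + l * (\<integral>x. \<xi> x * d x \<partial>\<nu>) \<le> l * (\<integral>x. \<bar>w x - f x\<bar> \<partial>\<nu>)"
    using int int\<xi> f l mult_left_mono[OF _ l] by (simp flip: distrib_left)
  have "g x * d x = (l * \<xi> x + g x) * d x - l * (\<xi> x * d x)" for x by (simp add: algebra_simps)
  then have "(\<integral>x. g x * d x \<partial>\<nu>) = (\<integral>x. (l * \<xi> x + g x) * d x \<partial>\<nu>) - l * (\<integral>x. \<xi> x * d x \<partial>\<nu>)"
    using L2_space_mult_integrable[OF p d] int\<xi> by simp
  with TV fid show ?thesis by (simp add: J_def d_def)
qed

text \<open>The truncations of an integrable \<open>w\<close> are in \<open>L\<^sup>2\<close> and converge to \<open>w\<close> in \<open>L\<^sup>1\<close>, where \<open>J\<close> is continuous.\<close>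

lemma L2_minimizer_in_minimizers:
  assumes u: "u \<in> L2_space \<nu>" and min: "\<And>w. w \<in> L2_space \<nu> \<Longrightarrow> J u \<le> J w"
  shows "u \<in> minimizers m \<nu> f l"
proof -
  have "J u \<le> J w" if w: "integrable \<nu> w" for w
  proof -
    define tr where "tr = (\<lambda>k x. max (- real k) (min (real k) (w x)))"
    have [measurable]: "w \<in> borel_measurable \<nu>" using w by simp
    have [measurable]: "tr k \<in> borel_measurable \<nu>" for k unfolding tr_def by measurable
    have tr: "tr k \<in> L2_space \<nu>" for k
    proof -
      have "integrable \<nu> (\<lambda>x. (tr k x)\<^sup>2)"
      proof (rule integrable_const_bound[of _ "(real k)\<^sup>2"])
        have "\<bar>tr k x\<bar> \<le> real k" for x by (auto simp: tr_def)
        then show "AE x in \<nu>. norm ((tr k x)\<^sup>2) \<le> (real k)\<^sup>2"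
          by (simp add: abs_le_square_iff[symmetric])
      qed measurable
      then show ?thesis by (simp add: L2_space_def)
    qed
    have "(\<lambda>k. \<integral>x. \<bar>tr k x - w x\<bar> \<partial>\<nu>) \<longlonglongrightarrow> (\<integral>x. 0 \<partial>\<nu>)"
    proof (rule integral_dominated_convergence[where w = "\<lambda>x. \<bar>w x\<bar>"])
      show "AE x in \<nu>. (\<lambda>k. \<bar>tr k x - w x\<bar>) \<longlonglongrightarrow> 0"
      proof (rule AE_I2)
        fix x
        obtain n :: nat where "\<bar>w x\<bar> \<le> real n" using real_arch_simple by blast
        then have "\<forall>k\<ge>n. \<bar>tr k x - w x\<bar> = 0" by (auto simp: tr_def)
        then show "(\<lambda>k. \<bar>tr k x - w x\<bar>) \<longlonglongrightarrow> 0"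
          by (intro tendsto_eventually) (auto simp: eventually_sequentially)
      qed
      show "AE x in \<nu>. norm \<bar>tr k x - w x\<bar> \<le> \<bar>w x\<bar>" for k
        by (auto simp: tr_def)
    qed (use w in \<open>auto\<close>)
    then have "(\<lambda>k. J w + (1 + l) * (\<integral>x. \<bar>tr k x - w x\<bar> \<partial>\<nu>)) \<longlonglongrightarrow> J w + (1 + l) * 0"
      by (intro tendsto_intros) simp
    moreover have "J u \<le> J w + (1 + l) * (\<integral>x. \<bar>tr k x - w x\<bar> \<partial>\<nu>)" for k
      using min[OF tr] J_lipschitz_L1[OF L2_space_integrable[OF tr] w] by (rule order_trans)
    ultimately show ?thesis
      using LIMSEQ_le_const[of _ "J w + (1 + l) * 0" "J u"] by simp
  qed
  then show ?thesis
    using L2_space_integrable[OF u] by (auto simp: minimizers_def energy_eq_J intro: ennreal_leI)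
qed

text \<open>On \<open>[a, b]\<close> the equation is used on the time interval \<open>(0, b + 1)\<close>, which contains \<open>[a, b]\<close> for every
  \<open>a > 0\<close>.\<close>

lemma strong_solution_gradient_flow:
  assumes "strong_solution m \<nu> f l v0 v"
  shows "lipschitz_gradient_flow \<nu> J ((1 + l) * sqrt (measure \<nu> UNIV)) v"
proof
  show "0 \<le> (1 + l) * sqrt (measure \<nu> UNIV)" using l by simp
  show "J u \<le> J w + (1 + l) * sqrt (measure \<nu> UNIV) * L2_dist \<nu> u w"
    if "u \<in> L2_space \<nu>" "w \<in> L2_space \<nu>" for u w
    using that by (rule J_lipschitz_L2)
  show "v t \<in> L2_space \<nu>" if "0 < t" for t
    using assms that by (auto simp: strong_solution_def L2_continuous_on_def)
  show "\<exists>g. has_L2_bochner_integral \<nu> (lebesgue_on {a..b}) g (\<lambda>x. v b x - v a x) \<and>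
      (AE s in lebesgue_on {a..b}. \<forall>w\<in>L2_space \<nu>. J (v s) - (\<integral>x. g s x * (w x - v s x) \<partial>\<nu>) \<le> J w)"
    if "0 < a" "a \<le> b" for a b
  proof -
    have "0 < b + 1" using that by simp
    then obtain g where deriv: "L2_W11_loc_deriv \<nu> (b + 1) v g"
      and incl: "AE t in lebesgue_on {0<..<b + 1}. \<exists>\<xi>\<in>sign_graph \<nu> (\<lambda>x. v t x - f x).
        (\<lambda>x. l * \<xi> x + g t x) \<in> Laplacian1 m \<nu> (v t)"
      using assms unfolding strong_solution_def by blast
    have "has_L2_bochner_integral \<nu> (lebesgue_on {a..b}) g (\<lambda>x. v b x - v a x)"
      using deriv that by (auto simp: L2_W11_loc_deriv_def)
    moreover have "AE t in lebesgue_on {a..b}. \<exists>\<xi>\<in>sign_graph \<nu> (\<lambda>x. v t x - f x).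
        (\<lambda>x. l * \<xi> x + g t x) \<in> Laplacian1 m \<nu> (v t)"
      using incl by (rule AE_lebesgue_on_subset) (use that in auto)
    then have "AE s in lebesgue_on {a..b}. \<forall>w\<in>L2_space \<nu>. J (v s) - (\<integral>x. g s x * (w x - v s x) \<partial>\<nu>) \<le> J w"
      by eventually_elim (auto intro: J_subgradient)
    ultimately show ?thesis by blast
  qed
qed

end


section \<open>Convergence of the flow\<close>

theorem theorem3p39:
  fixes m :: "'a::polish_space \<Rightarrow> 'a measure" and \<nu> :: "'a measure"
    and f v0 :: "'a \<Rightarrow> real" and l :: real and v :: "real \<Rightarrow> 'a \<Rightarrow> real"
  assumes "random_walk m"
    and "finite_radon_measure \<nu>" and "emeasure \<nu> UNIV \<noteq> 0"
    and "reversible m \<nu>" and "ergodic m \<nu>"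
    and "integrable \<nu> f" and "l > 0"
    and "v0 \<in> L2_space \<nu>" and "strong_solution m \<nu> f l v0 v"
    and "omega_limit \<nu> v \<noteq> {}"
  shows "\<exists>u \<in> minimizers m \<nu> f l \<inter> L2_space \<nu>. ((\<lambda>t. L2_dist \<nu> (v t) u) \<longlongrightarrow> 0) at_top"
proof -
  have "finite_measure \<nu>" "sets \<nu> = sets borel"
    using assms(2) by (auto simp: finite_radon_measure_def)
  then interpret walk_energy \<nu> m f l
    using assms by (auto simp: walk_energy_def walk_energy_axioms_def reversible_random_walk_def
        reversible_random_walk_axioms_def)
  interpret lipschitz_gradient_flow \<nu> J "(1 + l) * sqrt (measure \<nu> UNIV)" v
    using assms(9) by (rule strong_solution_gradient_flow)
  obtain u where u: "u \<in> omega_limit \<nu> v" using assms(10) by blast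
  then have "u \<in> L2_space \<nu>" by (simp add: omega_limit_def)
  moreover have "u \<in> minimizers m \<nu> f l"
    using \<open>u \<in> L2_space \<nu>\<close> omega_limit_minimizes[OF u] by (rule L2_minimizer_in_minimizers)
  ultimately show ?thesis
    using converges_to_omega_limit[OF u] by blast
qed

end
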